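(* Let $\phi:\mathbb{R}^n\to\mathbb{R}$ be continuously differentiable (not necessarily convex), let $A\in\mathbb{R}^{m\times n}$ have full row rank, let $b\in\mathbb{R}^m$, and suppose $\{x\in\mathbb{R}^n_+ : Ax=b\}\neq\emptyset$. Let $\mathcal{P}_{A,b}=\{y\in\mathbb{R}^n : A(y\circ y)=b\}$ and $f(y)=\phi(y\circ y)$. Suppose $y\in\mathcal{P}_{A,b}$ has regular representation $(M,N,r)$ and $x=y\circ y$. Then $y$ is a second-order stationary point of $\min\{f(y): y\in\mathcal{P}_{A,b}\}$ if and only if there exists $\lambda\in\mathbb{R}^m$ such that $$Ax=b,\quad x\in\mathbb{R}^n_+,\quad \nabla\phi(x)-A^\top\lambda\in\mathbb{R}^n_+,\quad (\nabla\phi(x)-A^\top\lambda)\circ x=0,$$ and $$(d\circ\mathbf{1}_y)^\top\nabla^2\phi(x)(d\circ\mathbf{1}_y)\ge 0\quad\text{for any } d\in\mathbb{R}^n \text{ satisfying } A(d\circ\mathbf{1}_y)=0.$$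
   Context: $\circ$ denotes the entrywise (Hadamard) product. $\mathbf{1}_y\in\mathbb{R}^n$ is the vector with entry $1$ at indices $i$ with $y_i\ne0$ and $0$ elsewhere. $\nabla^2\phi$ and $\nabla^2 f$ denote Hessians. Regular representation: for $y\in\mathcal{P}_{A,b}$, let $[M;N]\in\mathbb{R}^{m\times m}$ ($M$ stacked on top of $N$) be a full rank matrix such that the rows of $M$ form a basis of the range of $A\,\mathrm{Diag}(y)$ and the rows of $N$ form a basis of its orthogonal complement in $\mathbb{R}^m$; let $r=\mathrm{rank}(M)=\mathrm{rank}(A\,\mathrm{Diag}(y))$. Then $(M,N,r)$ is called a regular representation of $y$ in $\mathcal{P}_{A,b}$. For a closed set $S\subset\mathbb{R}^n$, $x\in S$, $h\in\mathbb{R}^n$: the contingent tangent cone is $\mathcal{T}_S(x)=\{h : \exists\, t_k\downarrow 0,\ \mathrm{dist}(x+t_kh,S)=o(t_k)\}$, and the outer second-order tangent set is $\mathcal{T}^{2}_S(x,h)=\{w : \exists\, t_k\downarrow 0,\ \mathrm{dist}(x+t_kh+t_k^2w/2,S)=o(t_k^2)\}$. First-order stationary point of $\min\{f(y): y\in\mathcal{P}_{A,b}\}$: $y\in\mathcal{P}_{A,b}$ with $\nabla f(y)^\top h\ge 0$ for any $h\in\mathcal{T}_{\mathcal{P}_{A,b}}(y)$. Second-order stationary point of $\min\{f(y): y\in\mathcal{P}_{A,b}\}$: a first-order stationary point $y$ such that $\nabla f(y)^\top w+h^\top\nabla^2f(y)h\ge0$ for any $h\in\mathcal{T}_{\mathcal{P}_{A,b}}(y)$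 satisfying $\nabla f(y)^\top h=0$ and any $w\in\mathcal{T}^2_{\mathcal{P}_{A,b}}(y,h)$.
   Formalization: The English assumes only that φ is continuously differentiable, so the Hessian of φ at x need not exist; the formal statement adds that the gradient of φ is differentiable at x = y∘y. *)

theory Defs
  imports "HOL-Analysis.Analysis" "HOL-Library.Landau_Symbols"
begin

text \<open>
  On \<^typ>\<open>real^'n\<close> the library product \<^term>\<open>x * y\<close> is the entrywise (Hadamard) product and
  \<^term>\<open>x \<le> y\<close> is the entrywise order, so \<^term>\<open>0 \<le> x\<close> says that \<^term>\<open>x\<close> lies in the
  nonnegative orthant.
\<close>

definition Diag :: "real^'n \<Rightarrow> real^'n^'n" where
  "Diag y = (\<chi> i j. if i = j then y $ i else 0)"

definition support_indicator :: "real^'n \<Rightarrow> real^'n" where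
  "support_indicator y = (\<chi> i. if y $ i \<noteq> 0 then 1 else 0)"

definition feasible_set :: "real^'n^'m \<Rightarrow> real^'m \<Rightarrow> (real^'n) set" where
  "feasible_set A b = {y. A *v (y * y) = b}"

definition grad :: "(real^'n \<Rightarrow> real) \<Rightarrow> real^'n \<Rightarrow> real^'n" where
  "grad f x = (THE g. GDERIV f x :> g)"

definition hessian :: "(real^'n \<Rightarrow> real) \<Rightarrow> real^'n \<Rightarrow> real^'n^'n" where
  "hessian f x = jacobian (grad f) (at x)"

definition continuously_differentiable :: "(real^'n \<Rightarrow> real) \<Rightarrow> bool" where
  "continuously_differentiable f \<longleftrightarrow>
     (\<forall>x. f differentiable (at x)) \<and> continuous_on UNIV (grad f)"

text \<open>
  A matrix whose number of rows is not fixed by its type (and may be zero, e.g. for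
  \<^term>\<open>y = 0\<close>) is represented by the list of its rows. Stacking is then list append, and the
  rank is the dimension of the span of the rows.
\<close>

definition rows_rank :: "(real^'m) list \<Rightarrow> nat" where
  "rows_rank M = dim (set M)"

definition rows_form_basis :: "(real^'m) list \<Rightarrow> (real^'m) set \<Rightarrow> bool" where
  "rows_form_basis M V \<longleftrightarrow> distinct M \<and> independent (set M) \<and> span (set M) = V"

definition regular_representation ::
  "real^'n^'m \<Rightarrow> real^'m \<Rightarrow> real^'n \<Rightarrow> (real^'m) list \<Rightarrow> (real^'m) list \<Rightarrow> nat \<Rightarrow> bool" where
  "regular_representation A b y M N r \<longleftrightarrow>
     y \<in> feasible_set A b \<and>
     length (M @ N) = CARD('m) \<and> rows_rank (M @ N) = CARD('m) \<and>
     rows_form_basis M (range ((*v) (A ** Diag y))) \<and>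
     rows_form_basis N (orthogonal_comp (range ((*v) (A ** Diag y)))) \<and>
     r = rows_rank M \<and> r = rank (A ** Diag y)"

definition decreases_to_zero :: "(nat \<Rightarrow> real) \<Rightarrow> bool" where
  "decreases_to_zero t \<longleftrightarrow> (\<forall>k. 0 < t k) \<and> decseq t \<and> t \<longlonglongrightarrow> 0"

definition tangent_cone :: "(real^'n) set \<Rightarrow> real^'n \<Rightarrow> (real^'n) set" where
  "tangent_cone S x =
     {h. \<exists>t. decreases_to_zero t \<and> (\<lambda>k. infdist (x + t k *\<^sub>R h) S) \<in> o(t)}"

definition second_order_tangent_set ::
  "(real^'n) set \<Rightarrow> real^'n \<Rightarrow> real^'n \<Rightarrow> (real^'n) set" where
  "second_order_tangent_set S x h =
     {w. \<exists>t. decreases_to_zero t \<and>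
       (\<lambda>k. infdist (x + t k *\<^sub>R h + ((t k)\<^sup>2 / 2) *\<^sub>R w) S) \<in> o(\<lambda>k. (t k)\<^sup>2)}"

definition first_order_stationary :: "(real^'n \<Rightarrow> real) \<Rightarrow> (real^'n) set \<Rightarrow> real^'n \<Rightarrow> bool" where
  "first_order_stationary f S y \<longleftrightarrow> y \<in> S \<and> (\<forall>h \<in> tangent_cone S y. grad f y \<bullet> h \<ge> 0)"

definition second_order_stationary :: "(real^'n \<Rightarrow> real) \<Rightarrow> (real^'n) set \<Rightarrow> real^'n \<Rightarrow> bool" where
  "second_order_stationary f S y \<longleftrightarrow>
     first_order_stationary f S y \<and>
     (\<forall>h \<in> tangent_cone S y. grad f y \<bullet> h = 0 \<longrightarrow>
        (\<forall>w \<in> second_order_tangent_set S y h.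
           grad f y \<bullet> w + h \<bullet> (hessian f y *v h) \<ge> 0))"

end

theory Submission
  imports Defs
begin

text \<open>
  Differentiating \<^term>\<open>A *v (z * z) = b\<close> shows that a tangent direction \<^term>\<open>h\<close> satisfies
  \<^term>\<open>A *v (y * h) = 0\<close> and a second-order tangent \<^term>\<open>w\<close> satisfies
  \<^term>\<open>A *v (y * w + h * h) = 0\<close>. Conversely, when \<^term>\<open>w\<close> vanishes off the support of
  \<^term>\<open>y\<close>, these equations suffice. The second-order form of \<^term>\<open>f\<close> at \<^term>\<open>(h, w)\<close> is
  twice \<^term>\<open>g \<bullet> (y * w + h * h) + 2 * ((y * h) \<bullet> (H *v (y * h)))\<close>, where \<^term>\<open>g\<close> and
  \<^term>\<open>H\<close> are the gradient and the Hessian of \<^term>\<open>\<phi>\<close> at \<^term>\<open>y * y\<close>.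
  Pairs with \<^term>\<open>y * h = 0\<close> reach every \<^term>\<open>d\<close> in the kernel of \<^term>\<open>A\<close> that is
  nonnegative off the support as \<^term>\<open>d = y * w + h * h\<close>, so that Farkas' lemma yields the multiplier; pairs with
  \<^term>\<open>y * w + h * h = 0\<close> isolate the Hessian condition.
\<close>

section \<open>Calculus of the entrywise product\<close>

lemma bounded_bilinear_hadamard: "bounded_bilinear ((*) :: real^'n \<Rightarrow> real^'n \<Rightarrow> real^'n)"
  unfolding bilinear_conv_bounded_bilinear[symmetric] bilinear_def
  by (auto intro!: linearI simp: vec_eq_iff algebra_simps)

lemmas hadamard_simps =
  bounded_bilinear.scaleR_left[OF bounded_bilinear_hadamard]
  bounded_bilinear.scaleR_right[OF bounded_bilinear_hadamard]

lemma inner_hadamard_left: "(a * b) \<bullet> c = b \<bullet> (a * c)" for a b c :: "real^'n"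
  by (simp add: inner_vec_def mult_ac)

section \<open>Farkas' lemma and existence of multipliers\<close>

text \<open>A finitely generated cone is closed, so a point outside it is strictly separated from it
  by some normal \<open>d\<close>. Since the cone contains 0 and is closed under scaling,
  \<open>d\<close> is nonnegative on the generators yet negative at \<open>g\<close>.\<close>

lemma farkas_cone:
  fixes g :: "'a::euclidean_space"
  assumes "finite S" and dual: "\<And>d. (\<And>s. s \<in> S \<Longrightarrow> 0 \<le> d \<bullet> s) \<Longrightarrow> 0 \<le> d \<bullet> g"
  shows "g \<in> convex_cone hull S"
proof (rule ccontr)
  assume "g \<notin> convex_cone hull S"
  then obtain d c where dc: "d \<bullet> g < c" and c: "\<And>v. v \<in> convex_cone hull S \<Longrightarrow> c < d \<bullet> v"
    using separating_hyperplane_closed_point[OF convex_convex_cone_hull closed_convex_cone_hull[OF assms(1)]]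
    by metis
  have "c < 0"
    using c[OF convex_cone_hull_contains_0] by simp
  have "0 \<le> d \<bullet> s" if "s \<in> S" for s
  proof (rule ccontr)
    assume neg: "\<not> 0 \<le> d \<bullet> s"
    \<comment> \<open>The scaling is chosen so that the inner product with \<open>d\<close> is
      exactly \<open>c\<close>, against the strict bound.\<close>
    have "(c / (d \<bullet> s)) *\<^sub>R s \<in> convex_cone hull S"
      using that neg \<open>c < 0\<close> by (intro convex_cone_hull_mul hull_inc) (auto intro: divide_nonpos_neg)
    from c[OF this] neg show False by simp
  qed
  then have "0 \<le> d \<bullet> g" by (rule dual)
  with dc \<open>c < 0\<close> show False by linarith
qed

text \<open>Farkas' lemma for the cone generated by the rows of \<open>A\<close> with both signs and
  the coordinate vectors outside \<open>I\<close>: nonnegativity of \<open>d\<close> on these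
  generators is exactly the premise of \<open>dual\<close>.\<close>

lemma multiplier_exists:
  fixes A :: "real^'n^'m" and g :: "real^'n" and I :: "'n set"
  assumes dual: "\<And>d. A *v d = 0 \<Longrightarrow> (\<And>i. i \<notin> I \<Longrightarrow> 0 \<le> d $ i) \<Longrightarrow> 0 \<le> d \<bullet> g"
  obtains l where "0 \<le> g - transpose A *v l" and "\<And>i. i \<in> I \<Longrightarrow> (g - transpose A *v l) $ i = 0"
proof -
  define L where "L = (*v) (transpose A)"
  have L: "linear L" by (simp add: L_def)
  \<comment> \<open>\<open>K\<close> collects the vectors that admit a multiplier. It is a convex
    cone containing the generators, hence contains their hull.\<close>
  define K where "K = {v. \<exists>l. (\<forall>i. (L l) $ i \<le> v $ i) \<and> (\<forall>i\<in>I. v $ i = (L l) $ i)}"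
  \<comment> \<open>\<open>B j\<close> is row \<open>j\<close> of \<open>A\<close>.\<close>
  define B where "B = (\<lambda>j. L (axis j 1))"
  define S where "S = range B \<union> range (\<lambda>j. - B j) \<union> (\<lambda>i. axis i 1) ` (- I)"
  have "g \<in> convex_cone hull S"
  proof (rule farkas_cone)
    show "finite S" by (simp add: S_def)
    fix d assume d: "\<And>s. s \<in> S \<Longrightarrow> 0 \<le> d \<bullet> s"
    have "(A *v d) $ j = 0" for j
    proof -
      have "(A *v d) $ j = d \<bullet> B j"
        by (simp add: B_def L_def inner_commute[of d] dot_lmul_matrix inner_axis')
      moreover have "0 \<le> d \<bullet> B j" "0 \<le> d \<bullet> (- B j)"
        using d unfolding S_def by blast+
      ultimately show ?thesis by simp
    qed
    moreover have "0 \<le> d $ i" if "i \<notin> I" for i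
      using d[of "axis i 1"] that by (simp add: S_def inner_axis)
    ultimately show "0 \<le> d \<bullet> g"
      by (intro dual) (auto simp: vec_eq_iff)
  qed
  also have "convex_cone hull S \<subseteq> K"
  proof (rule hull_minimal)
    show "S \<subseteq> K"
    proof
      fix s assume "s \<in> S"
      then consider j where "s = B j" | j where "s = - B j" | i where "i \<notin> I" "s = axis i 1"
        by (auto simp: S_def)
      then show "s \<in> K"
      proof cases
        case 1 then show ?thesis by (auto simp: K_def B_def intro!: exI[of _ "axis j 1"])
      next
        case 2 then show ?thesis
          by (auto simp: K_def B_def linear_neg[OF L] intro!: exI[of _ "- axis j 1"])
      next
        case 3 then show ?thesis
          by (auto simp: K_def axis_def linear_0[OF L] intro!: exI[of _ 0])
      qed
    qed
    show "convex_cone K"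
      unfolding convex_cone_iff
    proof (intro conjI ballI allI impI)
      show "0 \<in> K" by (auto simp: K_def linear_0[OF L] intro!: exI[of _ 0])
      show "u + v \<in> K" if u: "u \<in> K" and v: "v \<in> K" for u v
      proof -
        from u obtain l where "\<And>i. (L l) $ i \<le> u $ i" "\<And>i. i \<in> I \<Longrightarrow> u $ i = (L l) $ i"
          by (auto simp: K_def)
        moreover from v obtain l' where
          "\<And>i. (L l') $ i \<le> v $ i" "\<And>i. i \<in> I \<Longrightarrow> v $ i = (L l') $ i"
          by (auto simp: K_def)
        ultimately show ?thesis
          unfolding K_def by (auto simp: linear_add[OF L] intro!: exI[of _ "l + l'"] add_mono)
      qed
      show "c *\<^sub>R u \<in> K" if u: "u \<in> K" and c: "0 \<le> c" for u c
      proof -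
        from u obtain l where "\<And>i. (L l) $ i \<le> u $ i" "\<And>i. i \<in> I \<Longrightarrow> u $ i = (L l) $ i"
          by (auto simp: K_def)
        then show ?thesis
          using c unfolding K_def
          by (auto simp: linear_scale[OF L] intro!: exI[of _ "c *\<^sub>R l"] mult_left_mono)
      qed
    qed
  qed
  finally show thesis
    using that by (auto simp: K_def L_def less_eq_vec_def)
qed

section \<open>Gradient and Hessian of the squared composition\<close>

text \<open>As \<open>grad\<close> is a definite description, a representing vector must be shown to
  exist and be unique. The adjoint of the derivative, applied to 1, provides it.\<close>

lemma has_gderiv_grad:
  fixes \<phi> :: "real^'n \<Rightarrow> real"
  assumes "\<phi> differentiable (at z)"
  shows "GDERIV \<phi> z :> grad \<phi> z"
proof -
  obtain D where D: "(\<phi> has_derivative D) (at z)"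
    using assms by (auto simp: differentiable_def)
  have "D = (\<lambda>h. h \<bullet> adjoint D 1)"
    using adjoint_works[OF has_derivative_linear[OF D], of _ 1] by (auto simp: inner_commute)
  with D have ex: "GDERIV \<phi> z :> adjoint D 1"
    by (simp add: gderiv_def)
  have "u = v" if "GDERIV \<phi> z :> u" "GDERIV \<phi> z :> v" for u v
    using has_derivative_unique[OF that[unfolded gderiv_def]] by (metis vector_eq_ldot)
  with ex show ?thesis
    unfolding grad_def by (intro theI[where P = "\<lambda>g. GDERIV \<phi> z :> g"]) blast+
qed

lemma grad_eqI:
  fixes \<phi> :: "real^'n \<Rightarrow> real"
  assumes "GDERIV \<phi> z :> g"
  shows "grad \<phi> z = g"
proof -
  have "\<phi> differentiable (at z)"
    using assms by (auto simp: gderiv_def differentiable_def)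
  from has_gderiv_grad[OF this] assms have "(\<lambda>h. h \<bullet> grad \<phi> z) = (\<lambda>h. h \<bullet> g)"
    unfolding gderiv_def by (rule has_derivative_unique)
  then show ?thesis by (metis vector_eq_ldot)
qed

lemma has_derivative_square_vec:
  "((\<lambda>y :: real^'n. y * y) has_derivative (\<lambda>h. 2 *\<^sub>R (y * h))) (at y)"
  by (rule has_derivative_eq_rhs[OF bounded_bilinear.FDERIV[OF bounded_bilinear_hadamard has_derivative_ident has_derivative_ident]])
    (simp add: fun_eq_iff mult.commute scaleR_2)

lemma grad_square_composition:
  fixes \<phi> :: "real^'n \<Rightarrow> real"
  assumes "\<phi> differentiable (at (y * y))"
  shows "grad (\<lambda>y. \<phi> (y * y)) y = 2 *\<^sub>R (y * grad \<phi> (y * y))"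
proof (rule grad_eqI)
  have "((\<lambda>y. \<phi> (y * y)) has_derivative (\<lambda>h. (2 *\<^sub>R (y * h)) \<bullet> grad \<phi> (y * y))) (at y)"
    using has_derivative_compose[OF has_derivative_square_vec has_gderiv_grad[OF assms, unfolded gderiv_def]] .
  then show "GDERIV (\<lambda>y. \<phi> (y * y)) y :> 2 *\<^sub>R (y * grad \<phi> (y * y))"
    by (simp add: gderiv_def inner_hadamard_left)
qed

text \<open>Product rule applied to the gradient formula. That formula is differentiated as an
  identity of functions, hence differentiability of \<phi> at all points, while
  \<open>grad \<phi>\<close> is differentiated only at \<open>y * y\<close>.\<close>

lemma hessian_square_composition:
  fixes \<phi> :: "real^'n \<Rightarrow> real"
  assumes "\<And>z. \<phi> differentiable (at z)" and "grad \<phi> differentiable (at (y * y))"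
  shows "hessian (\<lambda>y. \<phi> (y * y)) y *v h =
    2 *\<^sub>R (h * grad \<phi> (y * y)) + 4 *\<^sub>R (y * (hessian \<phi> (y * y) *v (y * h)))"
proof -
  let ?f = "\<lambda>y. \<phi> (y * y)"
  have "(grad \<phi> has_derivative (\<lambda>h. hessian \<phi> (y * y) *v h)) (at (y * y))"
    using assms(2) by (simp add: jacobian_works hessian_def)
  from bounded_bilinear.FDERIV[OF bounded_bilinear_hadamard has_derivative_ident
      has_derivative_compose[OF has_derivative_square_vec this]]
  have *: "(grad ?f has_derivative
      (\<lambda>h. 2 *\<^sub>R (y * (hessian \<phi> (y * y) *v (2 *\<^sub>R (y * h))) + h * grad \<phi> (y * y)))) (at y)"
    using grad_square_composition[OF assms(1)] by (subst ext[of "grad ?f"]) (auto intro: has_derivative_scaleR_right)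
  then have "(grad ?f has_derivative (\<lambda>h. hessian ?f y *v h)) (at y)"
    unfolding hessian_def by (intro jacobian_works[THEN iffD1] differentiableI)
  from fun_cong[OF has_derivative_unique[OF this *], of h] show ?thesis
    by (simp add: algebra_simps hadamard_simps)
qed

section \<open>Tangent sets and the equations they satisfy\<close>

text \<open>Nearest points exist in a closed set, so a little-o distance becomes exact membership
  after a vanishing relative correction. It is used with \<tau> equal to \<open>t\<close> and to its
  square.\<close>

lemma smallo_infdistE:
  fixes p :: "nat \<Rightarrow> 'a::euclidean_space" and \<tau> :: "nat \<Rightarrow> real"
  assumes "closed S" "S \<noteq> {}" and pos: "\<And>k. 0 < \<tau> k" and o: "(\<lambda>k. infdist (p k) S) \<in> o(\<tau>)"
  obtains \<eta> where "\<eta> \<longlonglongrightarrow> 0" and "\<And>k. p k + \<tau> k *\<^sub>R \<eta> k \<in> S"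
proof -
  have "\<exists>z\<in>S. infdist (p k) S = dist (p k) z" for k
    using infdist_attains_inf[OF assms(1,2)] by metis
  then obtain z where z: "\<And>k. z k \<in> S" "\<And>k. infdist (p k) S = dist (p k) (z k)"
    by metis
  define \<eta> where "\<eta> k = (1 / \<tau> k) *\<^sub>R (z k - p k)" for k
  have "(\<lambda>k. infdist (p k) S / \<tau> k) \<longlonglongrightarrow> 0"
    by (rule smalloD_tendsto[OF o])
  also have "(\<lambda>k. infdist (p k) S / \<tau> k) = (\<lambda>k. norm (\<eta> k))"
  proof
    show "infdist (p k) S / \<tau> k = norm (\<eta> k)" for k
      using pos[of k] unfolding z(2) by (simp add: \<eta>_def dist_norm norm_minus_commute)
  qed
  finally have "\<eta> \<longlonglongrightarrow> 0"
    by (rule tendsto_norm_zero_cancel)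
  moreover have "p k + \<tau> k *\<^sub>R \<eta> k \<in> S" for k
    using pos[of k] z(1)[of k] by (simp add: \<eta>_def)
  ultimately show thesis by (rule that)
qed

lemma closed_feasible_set: "closed (feasible_set A b)"
proof -
  have "continuous_on UNIV (\<lambda>y. A *v (y * y))"
    by (intro linear_continuous_on_compose[OF _ matrix_vector_mul_linear]
        bounded_bilinear.continuous_on[OF bounded_bilinear_hadamard] continuous_on_id)
  then show ?thesis
    unfolding feasible_set_def by (intro closed_Collect_eq) auto
qed

lemma tangent_cone_feasible_setD:
  assumes "y \<in> feasible_set A b" and "h \<in> tangent_cone (feasible_set A b) y"
  shows "A *v (y * h) = 0"
proof -
  from assms(2) obtain t where t: "decreases_to_zero t"
    and o: "(\<lambda>k. infdist (y + t k *\<^sub>R h) (feasible_set A b)) \<in> o(t)"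
    by (auto simp: tangent_cone_def)
  have pos: "\<And>k. 0 < t k" and t0: "t \<longlonglongrightarrow> 0"
    using t by (auto simp: decreases_to_zero_def)
  obtain \<eta> where \<eta>: "\<eta> \<longlonglongrightarrow> 0"
    and feas: "\<And>k. y + t k *\<^sub>R h + t k *\<^sub>R \<eta> k \<in> feasible_set A b"
    using smallo_infdistE[OF closed_feasible_set _ pos o] assms(1) by blast
  \<comment> \<open>The difference quotient of the squared vector along the feasible points.
    \<open>A\<close> annihilates it exactly, and its limit is twice \<open>y * h\<close>.\<close>
  define q where "q k = 2 *\<^sub>R (y * (h + \<eta> k)) + t k *\<^sub>R ((h + \<eta> k) * (h + \<eta> k))" for k
  have "A *v q k = 0" for k
  proof -
    let ?z = "y + t k *\<^sub>R h + t k *\<^sub>R \<eta> k"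
    have "?z * ?z = y * y + t k *\<^sub>R q k"
      by (simp add: q_def vec_eq_iff algebra_simps power2_eq_square)
    with feas[of k] assms(1) have "t k *\<^sub>R (A *v q k) = 0"
      by (simp add: feasible_set_def matrix_vector_right_distrib matrix_vector_mult_scaleR)
    with pos[of k] show ?thesis by simp
  qed
  moreover have "(\<lambda>k. A *v q k) \<longlonglongrightarrow> A *v (2 *\<^sub>R (y * (h + 0)) + 0 *\<^sub>R ((h + 0) * (h + 0)))"
    unfolding q_def
    by (intro bounded_linear.tendsto[OF matrix_vector_mul_bounded_linear] tendsto_intros \<eta> t0
        bounded_bilinear.tendsto[OF bounded_bilinear_hadamard])
  ultimately have "A *v (2 *\<^sub>R (y * h)) = 0"
    by (simp add: LIMSEQ_const_iff)
  then show ?thesis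
    by (simp add: matrix_vector_mult_scaleR)
qed

lemma second_order_tangent_set_feasible_setD:
  assumes "y \<in> feasible_set A b" and "A *v (y * h) = 0"
    and "w \<in> second_order_tangent_set (feasible_set A b) y h"
  shows "A *v (y * w + h * h) = 0"
proof -
  from assms(3) obtain t where t: "decreases_to_zero t"
    and o: "(\<lambda>k. infdist (y + t k *\<^sub>R h + ((t k)\<^sup>2 / 2) *\<^sub>R w) (feasible_set A b)) \<in> o(\<lambda>k. (t k)\<^sup>2)"
    by (auto simp: second_order_tangent_set_def)
  have pos: "\<And>k. 0 < t k" and t0: "t \<longlonglongrightarrow> 0"
    using t by (auto simp: decreases_to_zero_def)
  have pos2: "0 < (t k)\<^sup>2" for k using pos[of k] by simp
  obtain \<eta> where \<eta>: "\<eta> \<longlonglongrightarrow> 0"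
    and feas: "\<And>k. y + t k *\<^sub>R h + ((t k)\<^sup>2 / 2) *\<^sub>R w + (t k)\<^sup>2 *\<^sub>R \<eta> k \<in> feasible_set A b"
    using smallo_infdistE[OF closed_feasible_set _ pos2 o] assms(1) by blast
  define p where "p k = h + t k *\<^sub>R ((1 / 2) *\<^sub>R w + \<eta> k)" for k
  \<comment> \<open>What remains of the squared vector after removing \<open>y * y\<close> and the
    linear term, divided by \<open>(t k)\<^sup>2\<close>.\<close>
  define q where "q k = y * (w + 2 *\<^sub>R \<eta> k) + p k * p k" for k
  have "A *v q k = 0" for k
  proof -
    let ?z = "y + t k *\<^sub>R h + ((t k)\<^sup>2 / 2) *\<^sub>R w + (t k)\<^sup>2 *\<^sub>R \<eta> k"
    have z: "?z = y + t k *\<^sub>R p k"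
      by (simp add: p_def algebra_simps power2_eq_square)
    have "?z * ?z = y * y + (2 * t k) *\<^sub>R (y * h) + (t k)\<^sup>2 *\<^sub>R q k"
      unfolding z by (simp add: q_def vec_eq_iff algebra_simps power2_eq_square) (simp add: p_def algebra_simps)
    with feas[of k] assms(1,2) have "(t k)\<^sup>2 *\<^sub>R (A *v q k) = 0"
      by (simp add: feasible_set_def matrix_vector_right_distrib matrix_vector_mult_scaleR)
    with pos[of k] show ?thesis by simp
  qed
  moreover have "(\<lambda>k. A *v q k) \<longlonglongrightarrow> A *v (y * (w + 2 *\<^sub>R 0) +
      (h + 0 *\<^sub>R ((1 / 2) *\<^sub>R w + 0)) * (h + 0 *\<^sub>R ((1 / 2) *\<^sub>R w + 0)))"
    unfolding q_def p_def
    by (intro bounded_linear.tendsto[OF matrix_vector_mul_bounded_linear] tendsto_intros \<eta> t0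
        bounded_bilinear.tendsto[OF bounded_bilinear_hadamard])
  ultimately show ?thesis
    by (simp add: LIMSEQ_const_iff)
qed

text \<open>The same sequence works: the quadratic term moves the point by \<open>o(t)\<close> only.
  Hence constructing a second-order tangent \<open>w\<close> also certifies its direction
  \<open>h\<close>.\<close>

lemma tangent_cone_if_second_order_tangent:
  assumes "w \<in> second_order_tangent_set S y h"
  shows "h \<in> tangent_cone S y"
proof -
  from assms obtain t where t: "decreases_to_zero t"
    and o: "(\<lambda>k. infdist (y + t k *\<^sub>R h + ((t k)\<^sup>2 / 2) *\<^sub>R w) S) \<in> o(\<lambda>k. (t k)\<^sup>2)"
    by (auto simp: second_order_tangent_set_def)
  have pos: "\<And>k. 0 < t k" and t0: "t \<longlonglongrightarrow> 0"
    using t by (auto simp: decreases_to_zero_def)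
  have sq: "(\<lambda>k. (t k)\<^sup>2) \<in> o(t)"
    using t0 pos by (intro smalloI_tendsto) (auto simp: power2_eq_square less_imp_neq[symmetric])
  let ?p = "\<lambda>k. y + t k *\<^sub>R h" and ?u = "\<lambda>k. ((t k)\<^sup>2 / 2) *\<^sub>R w"
  have "(\<lambda>k. (t k)\<^sup>2 * (norm w / 2)) \<in> o(t)"
    using sq by (cases "w = 0") simp_all
  with landau_o.small_trans[OF o sq]
  have "(\<lambda>k. infdist (?p k + ?u k) S + (t k)\<^sup>2 * (norm w / 2)) \<in> o(t)"
    by (rule sum_in_smallo)
  moreover have "infdist (?p k) S \<le> infdist (?p k + ?u k) S + (t k)\<^sup>2 * (norm w / 2)" for k
    using infdist_triangle[of "?p k" S "?p k + ?u k"] by (simp add: dist_norm)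
  ultimately have "(\<lambda>k. infdist (?p k) S) \<in> o(t)"
    by (elim landau_o.big_small_trans[OF bigoI[of _ 1], rotated])
      (auto intro!: always_eventually simp: infdist_nonneg order_trans[OF _ abs_ge_self])
  with t show ?thesis
    by (auto simp: tangent_cone_def)
qed

section \<open>Construction of second-order tangents\<close>

text \<open>Difference of squares: the radicand agrees with the square of the quadratic polynomial
  up to order \<open>t\<^sup>3\<close>, and the sum of root and polynomial tends to
  \<open>2 * a\<close>, which is nonzero. The factor \<open>sgn a\<close> selects the branch through
  \<open>a\<close>.\<close>

lemma sqrt_curve_second_order:
  fixes a h w :: real
  assumes "a \<noteq> 0"
  shows "((\<lambda>t. (sgn a * sqrt (a\<^sup>2 + 2 * t * (a * h) + t\<^sup>2 * (a * w + h\<^sup>2)) - (a + t * h + t\<^sup>2 / 2 * w)) / t\<^sup>2)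
    \<longlongrightarrow> 0) (at_right 0)"
proof -
  define q where "q t = a\<^sup>2 + 2 * t * (a * h) + t\<^sup>2 * (a * w + h\<^sup>2)" for t
  define z where "z t = sgn a * sqrt (q t)" for t
  define p where "p t = a + t * h + t\<^sup>2 / 2 * w" for t
  have q: "(q \<longlongrightarrow> a\<^sup>2) (at_right 0)"
    unfolding q_def by (auto intro!: tendsto_eq_intros)
  have "(z \<longlongrightarrow> sgn a * sqrt (a\<^sup>2)) (at_right 0)"
    unfolding z_def by (intro tendsto_intros q)
  then have z: "(z \<longlongrightarrow> a) (at_right 0)"
    by (simp add: sgn_mult_abs)
  have p: "(p \<longlongrightarrow> a) (at_right 0)"
    unfolding p_def by (auto intro!: tendsto_eq_intros)
  have zp: "((\<lambda>t. z t + p t) \<longlongrightarrow> 2 * a) (at_right 0)"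
    using tendsto_add[OF z p] by simp
  have "((\<lambda>t. - (t * h * w + t\<^sup>2 * w\<^sup>2 / 4) / (z t + p t)) \<longlongrightarrow> 0) (at_right 0)"
    using assms by (intro tendsto_eq_rhs[OF tendsto_divide[OF _ zp, of _ 0]]) (auto intro!: tendsto_eq_intros)
  moreover have "eventually (\<lambda>t. - (t * h * w + t\<^sup>2 * w\<^sup>2 / 4) / (z t + p t) = (z t - p t) / t\<^sup>2) (at_right 0)"
  proof -
    have "eventually (\<lambda>t. 0 < q t) (at_right 0)"
      using assms by (intro order_tendstoD(1)[OF q]) auto
    moreover have "eventually (\<lambda>t. z t + p t \<noteq> 0) (at_right 0)"
      using assms by (intro tendsto_imp_eventually_ne[OF zp]) auto
    ultimately show ?thesis
      using eventually_at_right_less[of 0]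
    proof eventually_elim
      case (elim t)
      have "(z t)\<^sup>2 = q t"
        using elim assms by (simp add: z_def power_mult_distrib sgn_if)
      then have "(z t - p t) * (z t + p t) = q t - (p t)\<^sup>2"
        by (simp add: power2_eq_square algebra_simps)
      also have "\<dots> = - (t * h * w + t\<^sup>2 * w\<^sup>2 / 4) * t\<^sup>2"
        by (simp add: q_def p_def power2_eq_square algebra_simps)
      finally show ?case
        using elim by (simp add: frac_eq_eq)
    qed
  qed
  ultimately have "((\<lambda>t. (z t - p t) / t\<^sup>2) \<longlongrightarrow> 0) (at_right 0)"
    by (rule Lim_transform_eventually)
  then show ?thesis
    by (simp add: z_def p_def q_def)
qed

text \<open>
  On the support of \<^term>\<open>y\<close> the curve prescribes the squares \<^term>\<open>z * z\<close> as a quadratic polynomial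
  in the parameter and takes square roots; off the support it is linear. Thus it stays exactly
  feasible even where the feasible set is not a manifold.
\<close>

lemma second_order_tangent_set_feasible_setI:
  fixes A :: "real^'n^'m"
  assumes "y \<in> feasible_set A b" and "A *v (y * h) = 0" and "A *v (y * w + h * h) = 0"
    and off_support: "\<And>i. y $ i = 0 \<Longrightarrow> w $ i = 0"
  shows "w \<in> second_order_tangent_set (feasible_set A b) y h"
proof -
  define q where "q t = y * y + (2 * t) *\<^sub>R (y * h) + t\<^sup>2 *\<^sub>R (y * w + h * h)" for t
  define z where "z t = (\<chi> i. if y $ i = 0 then t * h $ i else sgn (y $ i) * sqrt (q t $ i))" for t
  define p where "p t = y + t *\<^sub>R h + (t\<^sup>2 / 2) *\<^sub>R w" for t
  have Aq: "A *v q t = b" for t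
    using assms(1,2,3) by (simp add: q_def feasible_set_def matrix_vector_right_distrib matrix_vector_mult_scaleR)
  have "eventually (\<lambda>t. 0 < q t $ i) (at_right 0)" if "y $ i \<noteq> 0" for i
  proof -
    have "((\<lambda>t. q t $ i) \<longlongrightarrow> (y $ i)\<^sup>2) (at_right 0)"
      unfolding q_def by (auto intro!: tendsto_eq_intros simp: power2_eq_square)
    with that show ?thesis by (intro order_tendstoD(1)) auto
  qed
  then have "eventually (\<lambda>t. \<forall>i. y $ i \<noteq> 0 \<longrightarrow> 0 < q t $ i) (at_right 0)"
    by (intro eventually_all_finite) (auto simp: eventually_mono)
  then have feas: "eventually (\<lambda>t. z t \<in> feasible_set A b) (at_right 0)"
  proof eventually_elim
    case (elim t)
    have "z t * z t = q t"
    proof (rule vec_eq_iff[THEN iffD2], rule allI)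
      fix i show "(z t * z t) $ i = q t $ i"
      proof (cases "y $ i = 0")
        \<comment> \<open>Off the support the prescribed square reduces to that of
          \<open>t * h $ i\<close>.\<close>
        case True then show ?thesis
          by (simp add: z_def q_def power2_eq_square)
      next
        case False
        then have "(z t * z t) $ i = (sgn (y $ i) * sqrt (q t $ i))\<^sup>2"
          by (simp add: z_def power2_eq_square)
        also have "\<dots> = q t $ i"
          using False elim[rule_format, of i] by (simp add: power_mult_distrib sgn_if)
        finally show ?thesis .
      qed
    qed
    then show ?case by (simp add: feasible_set_def Aq)
  qed
  have "((\<lambda>t. (1 / t\<^sup>2) *\<^sub>R (z t - p t)) \<longlongrightarrow> 0) (at_right 0)"
  proof (rule vec_tendstoI)
    fix i show "((\<lambda>t. ((1 / t\<^sup>2) *\<^sub>R (z t - p t)) $ i) \<longlongrightarrow> 0 $ i) (at_right 0)"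
    proof (cases "y $ i = 0")
      \<comment> \<open>Since \<open>w\<close> vanishes here, curve and polynomial coincide.\<close>
      case True then show ?thesis by (simp add: z_def p_def off_support)
    next
      case False
      from sqrt_curve_second_order[OF this, of "h $ i" "w $ i"] False show ?thesis
        by (simp add: z_def p_def q_def power2_eq_square)
    qed
  qed
  then have bound: "((\<lambda>t. norm ((1 / t\<^sup>2) *\<^sub>R (z t - p t))) \<longlongrightarrow> 0) (at_right 0)"
    by (rule tendsto_norm_zero)
  have lim: "((\<lambda>t. infdist (p t) (feasible_set A b) / t\<^sup>2) \<longlongrightarrow> 0) (at_right 0)"
  proof (rule tendsto_sandwich[OF _ _ tendsto_const bound])
    show "eventually (\<lambda>t. 0 \<le> infdist (p t) (feasible_set A b) / t\<^sup>2) (at_right 0)"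
      by (simp add: infdist_nonneg)
    show "eventually (\<lambda>t. infdist (p t) (feasible_set A b) / t\<^sup>2 \<le> norm ((1 / t\<^sup>2) *\<^sub>R (z t - p t))) (at_right 0)"
      using feas
    proof eventually_elim
      case (elim t)
      then show ?case
        using infdist_le[OF elim, of "p t"] by (simp add: dist_norm norm_minus_commute divide_right_mono)
    qed
  qed
  \<comment> \<open>\<open>Suc\<close> keeps the first term positive, as
    \<open>inverse 0 = 0\<close>.\<close>
  define \<tau> where "\<tau> k = inverse (real (Suc k))" for k
  have \<tau>: "decreases_to_zero \<tau>"
    using LIMSEQ_inverse_real_of_nat unfolding decreases_to_zero_def \<tau>_def
    by (auto simp: decseq_def field_simps)
  then have "filterlim \<tau> (at_right 0) sequentially"
    by (auto simp: decreases_to_zero_def intro!: tendsto_imp_filterlim_at_right)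
  from filterlim_compose[OF lim this]
  have "(\<lambda>k. infdist (p (\<tau> k)) (feasible_set A b)) \<in> o(\<lambda>k. (\<tau> k)\<^sup>2)"
    by (intro smalloI_tendsto) (auto simp: \<tau>_def)
  with \<tau> show ?thesis
    unfolding second_order_tangent_set_def p_def by blast
qed

section \<open>Stationarity and the multiplier conditions\<close>

theorem lemma2:
  fixes \<phi> f :: "real^'n \<Rightarrow> real"
    and A :: "real^'n^'m" and b :: "real^'m"
    and x y :: "real^'n"
    and M N :: "(real^'m) list" and r :: nat
  assumes "continuously_differentiable \<phi>"
    and "rank A = CARD('m)"
    and "{x :: real^'n. 0 \<le> x \<and> A *v x = b} \<noteq> {}"
    and "f = (\<lambda>y. \<phi> (y * y))"
    and "y \<in> feasible_set A b"
    and "regular_representation A b y M N r"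
    and "x = y * y"
    and "grad \<phi> differentiable (at x)"
  shows "second_order_stationary f (feasible_set A b) y \<longleftrightarrow>
    (\<exists>l :: real^'m.
       A *v x = b \<and> 0 \<le> x \<and>
       0 \<le> grad \<phi> x - transpose A *v l \<and>
       (grad \<phi> x - transpose A *v l) * x = 0 \<and>
       (\<forall>d :: real^'n. A *v (d * support_indicator y) = 0 \<longrightarrow>
          (d * support_indicator y) \<bullet> (hessian \<phi> x *v (d * support_indicator y)) \<ge> 0))"
proof -
  let ?S = "feasible_set A b"
  define g where "g = grad \<phi> x"
  define H where "H = hessian \<phi> x"
  have diff: "\<phi> differentiable (at z)" for z
    using assms(1) by (simp add: continuously_differentiable_def)
  have grad_f: "grad f y \<bullet> v = 2 * (g \<bullet> (y * v))" for v
    using grad_square_composition[OF diff, of y]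
    by (simp add: assms(4,7) g_def inner_hadamard_left inner_commute[of v] inner_hadamard_left[of y])
  have hess_f: "v \<bullet> (hessian f y *v v) = 2 * (g \<bullet> (v * v)) + 4 * ((y * v) \<bullet> (H *v (y * v)))" for v
    using hessian_square_composition[OF diff, of y v] assms(8)
    by (simp add: assms(4,7) g_def H_def inner_add_right inner_hadamard_left[symmetric] inner_commute mult.commute)
  have Ax: "A *v x = b" and x0: "0 \<le> x"
    using assms(5) by (simp_all add: assms(7) feasible_set_def less_eq_vec_def)
  show ?thesis
  proof
    assume so: "second_order_stationary f ?S y"
    have second: "0 \<le> g \<bullet> (y * w + h * h) + 2 * ((y * h) \<bullet> (H *v (y * h)))"
      if "A *v (y * h) = 0" "A *v (y * w + h * h) = 0" "\<And>i. y $ i = 0 \<Longrightarrow> w $ i = 0"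
        "g \<bullet> (y * h) = 0" for h w
    proof -
      have w: "w \<in> second_order_tangent_set ?S y h"
        by (intro second_order_tangent_set_feasible_setI assms(5) that)
      with so that(4) tangent_cone_if_second_order_tangent[OF w]
      have "0 \<le> grad f y \<bullet> w + h \<bullet> (hessian f y *v h)"
        by (auto simp: second_order_stationary_def grad_f)
      then show ?thesis
        by (simp add: grad_f hess_f inner_add_right)
    qed
    have dual: "0 \<le> d \<bullet> g" if Ad: "A *v d = 0" and d: "\<And>i. i \<notin> {i. y $ i \<noteq> 0} \<Longrightarrow> 0 \<le> d $ i" for d
    proof -
      \<comment> \<open>On the support \<open>y * w\<close> can take any value; off it only
        \<open>h * h\<close> contributes, which realizes the nonnegative entries of
        \<open>d\<close>. As \<open>y * h = 0\<close>, the Hessian term disappears.\<close>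
      define w where "w = (\<chi> i. if y $ i = 0 then 0 else d $ i / y $ i)"
      define h where "h = (\<chi> i. if y $ i = 0 then sqrt (d $ i) else 0)"
      have yh: "y * h = 0"
        by (simp add: h_def vec_eq_iff)
      have yw: "y * w + h * h = d"
        using d by (simp add: w_def h_def vec_eq_iff)
      show ?thesis
        using second[of h w] by (simp add: yh yw Ad inner_commute) (simp add: w_def)
    qed
    obtain l where l0: "0 \<le> g - transpose A *v l"
      and ly: "\<And>i. i \<in> {i. y $ i \<noteq> 0} \<Longrightarrow> (g - transpose A *v l) $ i = 0"
      by (rule multiplier_exists[of A "{i. y $ i \<noteq> 0}" g, OF dual]) blast+
    have compl: "(g - transpose A *v l) * x = 0"
      using ly by (auto simp: vec_eq_iff assms(7))
    have "0 \<le> u \<bullet> (H *v u)" if Au: "A *v u = 0" and u: "\<And>i. y $ i = 0 \<Longrightarrow> u $ i = 0" for u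
    proof -
      \<comment> \<open>Here \<open>w\<close> solves \<open>y * w = - (h * h)\<close> on the
        support, leaving only the Hessian term. Off the support division by zero gives 0 in both
        vectors, as required of \<open>w\<close>.\<close>
      define h where "h = (\<chi> i. u $ i / y $ i)"
      define w where "w = (\<chi> i. - (u $ i)\<^sup>2 / (y $ i) ^ 3)"
      have yh: "y * h = u"
        using u by (auto simp: h_def vec_eq_iff)
      have yw: "y * w + h * h = 0"
        using u by (auto simp: h_def w_def vec_eq_iff power2_eq_square power3_eq_cube)
      \<comment> \<open>The second-order condition applies only to directions orthogonal to the
        gradient. Complementarity and \<open>A *v u = 0\<close> supply this.\<close>
      have "(g - transpose A *v l) \<bullet> u = 0"
        using ly u by (intro inner_vec_def[THEN trans] sum.neutral) auto
      then have "g \<bullet> u = 0"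
        using Au by (simp add: inner_diff_left dot_lmul_matrix)
      with second[of h w] Au u show ?thesis
        by (simp add: yh yw) (simp add: w_def)
    qed
    then have "\<forall>d. A *v (d * support_indicator y) = 0 \<longrightarrow>
        0 \<le> (d * support_indicator y) \<bullet> (H *v (d * support_indicator y))"
      by (auto simp: support_indicator_def)
    with Ax x0 l0 compl show "\<exists>l. A *v x = b \<and> 0 \<le> x \<and> 0 \<le> grad \<phi> x - transpose A *v l \<and>
       (grad \<phi> x - transpose A *v l) * x = 0 \<and>
       (\<forall>d :: real^'n. A *v (d * support_indicator y) = 0 \<longrightarrow>
          (d * support_indicator y) \<bullet> (hessian \<phi> x *v (d * support_indicator y)) \<ge> 0)"
      unfolding g_def H_def by blast
  next
    assume "\<exists>l. A *v x = b \<and> 0 \<le> x \<and> 0 \<le> grad \<phi> x - transpose A *v l \<and>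
       (grad \<phi> x - transpose A *v l) * x = 0 \<and>
       (\<forall>d :: real^'n. A *v (d * support_indicator y) = 0 \<longrightarrow>
          (d * support_indicator y) \<bullet> (hessian \<phi> x *v (d * support_indicator y)) \<ge> 0)"
    then obtain l where s0: "0 \<le> g - transpose A *v l" and sx: "(g - transpose A *v l) * x = 0"
      and H: "\<And>d. A *v (d * support_indicator y) = 0 \<Longrightarrow>
        0 \<le> (d * support_indicator y) \<bullet> (H *v (d * support_indicator y))"
      unfolding g_def H_def by blast
    define s where "s = g - transpose A *v l"
    \<comment> \<open>Splits the gradient into slack and multiplier parts; the latter vanishes on
      the kernel of \<open>A\<close>.\<close>
    have g: "g \<bullet> v = s \<bullet> v + l \<bullet> (A *v v)" for v
      by (simp add: s_def inner_diff_left dot_lmul_matrix)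
    have "s $ i = 0 \<or> y $ i = 0" for i
      using sx unfolding s_def[symmetric] assms(7) by (auto simp: vec_eq_iff)
    then have sy: "s \<bullet> (y * v) = 0" for v
      unfolding inner_vec_def by (intro sum.neutral) auto
    have ss: "0 \<le> s \<bullet> (v * v)" for v
      using s0 unfolding s_def[symmetric] inner_vec_def
      by (intro sum_nonneg) (auto simp: less_eq_vec_def)
    have q: "0 \<le> (y * h) \<bullet> (H *v (y * h))" if "A *v (y * h) = 0" for h
    proof -
      have "(y * h) * support_indicator y = y * h"
        by (simp add: support_indicator_def vec_eq_iff)
      with H[of "y * h"] that show ?thesis by simp
    qed
    show "second_order_stationary f ?S y"
      unfolding second_order_stationary_def first_order_stationary_def
    proof (intro conjI ballI impI)
      show "y \<in> ?S" by (rule assms(5))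
      fix h assume "h \<in> tangent_cone ?S y"
      with assms(5) have Ah: "A *v (y * h) = 0" by (rule tangent_cone_feasible_setD)
      then show "0 \<le> grad f y \<bullet> h"
        by (simp add: grad_f g sy)
      fix w assume "w \<in> second_order_tangent_set ?S y h"
      with assms(5) Ah have "A *v (y * w + h * h) = 0"
        by (rule second_order_tangent_set_feasible_setD)
      \<comment> \<open>Feasibility removes the multiplier part and complementarity removes
        \<open>y * w\<close>. What is left is a nonnegative combination of squares, weighted by the
        slack.\<close>
      then have "g \<bullet> (y * w + h * h) = s \<bullet> (h * h)"
        by (simp add: g inner_add_right[of s] sy)
      moreover have "grad f y \<bullet> w + h \<bullet> (hessian f y *v h) =
          2 * (g \<bullet> (y * w + h * h)) + 4 * ((y * h) \<bullet> (H *v (y * h)))"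
        by (simp add: grad_f hess_f inner_add_right)
      ultimately show "0 \<le> grad f y \<bullet> w + h \<bullet> (hessian f y *v h)"
        using ss[of h] q[OF Ah] by simp
    qed
  qed
qed

end
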